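(* For any $y\in\mathbb{R}^n$, $X\in\mathbb{R}^{n\times p}$, and $\lambda>0$, any two lasso solutions $\hat\beta^{(1)}$ and $\hat\beta^{(2)}$ (minimizers of $\frac12\|y-X\beta\|_2^2+\lambda\|\beta\|_1$ over $\beta\in\mathbb{R}^p$) must satisfy $$\hat\beta^{(1)}_i\cdot\hat\beta^{(2)}_i\ge 0\quad\text{for } i=1,\dots,p.$$ In other words, any two lasso solutions must have the same signs over their common support.
   Context: Both lasso solutions are taken at the same $y,X,\lambda$. The support of $\beta$ is $\{i:\beta_i\ne0\}$. *)

theory Defs
  imports "HOL-Analysis.Analysis"
begin

definition l1_norm :: "real ^ 'p \<Rightarrow> real" where
  "l1_norm b = (\<Sum>i\<in>UNIV. \<bar>b $ i\<bar>)"

(* norm on real ^ 'n is the Euclidean norm; X has rows indexed by 'n and columns indexed by 'p *)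
definition lasso_objective ::
    "real ^ 'n \<Rightarrow> real ^ 'p ^ 'n \<Rightarrow> real \<Rightarrow> real ^ 'p \<Rightarrow> real" where
  "lasso_objective y X lam b = 1 / 2 * (norm (y - X *v b))\<^sup>2 + lam * l1_norm b"

definition lasso_solution ::
    "real ^ 'n \<Rightarrow> real ^ 'p ^ 'n \<Rightarrow> real \<Rightarrow> real ^ 'p \<Rightarrow> bool" where
  "lasso_solution y X lam b \<longleftrightarrow> is_arg_min (lasso_objective y X lam) (\<lambda>_. True) b"

definition support :: "real ^ 'p \<Rightarrow> 'p set" where
  "support b = {i. b $ i \<noteq> 0}"

end

theory Submission
  imports Defs
begin

text \<open>
  If two solutions had opposite signs in some coordinate, their midpoint would do strictly better
  than both: the squared residual is convex in the coefficient vector, so it does not exceed its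
  average at the midpoint, while cancellation in that coordinate makes the penalty strictly
  smaller than its average (\<open>l1_norm_midpoint_less\<close>), and the penalty has positive weight.
  Comparing objective values directly in this way avoids the subgradient optimality conditions
  and the fact that all solutions have the same fitted value.
\<close>

lemma norm_midpoint_sq_le:
  fixes u v :: "'a::real_inner"
  shows "(norm (midpoint u v))\<^sup>2 \<le> ((norm u)\<^sup>2 + (norm v)\<^sup>2) / 2"
proof -
  \<comment> \<open>By the parallelogram law the gap is the square of half the distance.\<close>
  have "((norm u)\<^sup>2 + (norm v)\<^sup>2) / 2 - (norm (midpoint u v))\<^sup>2 = (norm (u - v))\<^sup>2 / 4"
    by (simp add: midpoint_def power2_norm_eq_inner inner_add_left inner_add_right
        inner_diff_left inner_diff_right inner_commute field_simps)
  moreover have "0 \<le> (norm (u - v))\<^sup>2 / 4"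
    by simp
  ultimately show ?thesis
    by linarith
qed

lemma residual_midpoint:
  fixes X :: "real ^ 'p ^ 'n"
  shows "y - X *v midpoint a b = midpoint (y - X *v a) (y - X *v b)"
  by (simp add: midpoint_def matrix_vector_mult_scaleR matrix_vector_right_distrib
      scaleR_right_distrib scaleR_right_diff_distrib flip: scaleR_left_distrib)

text \<open>
  The triangle inequality for the absolute value is strict exactly when the two numbers have
  opposite signs, and one such coordinate is enough to make the sum over all coordinates strict.
\<close>

lemma l1_norm_midpoint_less:
  fixes a b :: "real ^ 'p"
  assumes "a $ i * b $ i < 0"
  shows "l1_norm (midpoint a b) < (l1_norm a + l1_norm b) / 2"
proof -
  have "(\<Sum>j\<in>UNIV. \<bar>midpoint a b $ j\<bar>) < (\<Sum>j\<in>UNIV. (\<bar>a $ j\<bar> + \<bar>b $ j\<bar>) / 2)"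
  proof (rule sum_strict_mono_ex1)
    show "\<forall>j\<in>UNIV. \<bar>midpoint a b $ j\<bar> \<le> (\<bar>a $ j\<bar> + \<bar>b $ j\<bar>) / 2"
      by (simp add: midpoint_def abs_mult abs_triangle_ineq)
    show "\<exists>j\<in>UNIV. \<bar>midpoint a b $ j\<bar> < (\<bar>a $ j\<bar> + \<bar>b $ j\<bar>) / 2"
      using assms by (intro bexI[of _ i]) (auto simp: midpoint_def abs_mult mult_less_0_iff)
  qed simp
  then show ?thesis
    by (simp add: l1_norm_def sum.distrib flip: sum_divide_distrib)
qed

lemma lasso_objective_midpoint_less:
  fixes y :: "real ^ 'n" and X :: "real ^ 'p ^ 'n"
  assumes "lam > 0" and "a $ i * b $ i < 0"
  shows "lasso_objective y X lam (midpoint a b)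
    < (lasso_objective y X lam a + lasso_objective y X lam b) / 2"
proof -
  have "(norm (y - X *v midpoint a b))\<^sup>2
      \<le> ((norm (y - X *v a))\<^sup>2 + (norm (y - X *v b))\<^sup>2) / 2"
    unfolding residual_midpoint by (rule norm_midpoint_sq_le)
  moreover have "lam * l1_norm (midpoint a b) < lam * ((l1_norm a + l1_norm b) / 2)"
    using assms by (intro mult_strict_left_mono l1_norm_midpoint_less)
  ultimately show ?thesis
    by (simp add: lasso_objective_def field_simps)
qed

theorem lemma11:
  fixes y :: "real ^ 'n" and X :: "real ^ 'p ^ 'n" and lam :: real
    and b1 b2 :: "real ^ 'p"
  assumes "lam > 0"
    and "lasso_solution y X lam b1"
    and "lasso_solution y X lam b2"
  shows "(\<forall>i. b1 $ i * b2 $ i \<ge> 0) \<and>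
    (\<forall>i \<in> support b1 \<inter> support b2. sgn (b1 $ i) = sgn (b2 $ i))"
proof -
  have nonneg: "b1 $ i * b2 $ i \<ge> 0" for i
  proof (rule ccontr)
    let ?f = "lasso_objective y X lam"
    assume "\<not> b1 $ i * b2 $ i \<ge> 0"
    then have "?f (midpoint b1 b2) < (?f b1 + ?f b2) / 2"
      using assms(1) by (intro lasso_objective_midpoint_less[of _ _ i]) auto
    moreover have "?f b1 \<le> ?f (midpoint b1 b2)" "?f b2 \<le> ?f (midpoint b1 b2)"
      using assms(2,3) by (auto simp: lasso_solution_def is_arg_min_linorder)
    ultimately show False
      by (simp add: field_simps)
  qed
  moreover have "sgn (b1 $ i) = sgn (b2 $ i)" if "i \<in> support b1 \<inter> support b2" for i
    using nonneg[of i] that by (auto simp: support_def zero_le_mult_iff sgn_if)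
  ultimately show ?thesis
    by blast
qed

end
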